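(* Let $P$ be a right LCM Ore semigroup that satisfies the descending chain condition, and let $T:P\to\mathcal{B}(\mathcal{H})$ be a unital contractive representation on a Hilbert space $\mathcal{H}$. Suppose $Z(F)\ge0$ for all finite $F\subset P_{min}$. Then $Z(F)\ge0$ for all finite $F\subset P$.
   Context: A unital semigroup $P$ (identity $e$) is right LCM if it is left cancellative ($pa=pb\Rightarrow a=b$) and for all $p,q\in P$ either $pP\cap qP=\emptyset$ or $pP\cap qP=rP$ for some $r\in P$. $P^\ast$ is the set of invertible elements. $P$ is Ore if $pP\cap qP\ne\emptyset$ for all $p,q\in P$. $P$ satisfies the descending chain condition if there are no infinite sequences $x_n\in P$, $y_n\in P\setminus P^\ast$ such that for every $n$ either $x_n=x_{n+1}y_n$ or $x_n=y_nx_{n+1}$. An element $x\in P$ is minimal if $x\notin P^\ast$ and whenever $x=yz$ with $y,z\in P$, then $y\in P^\ast$ or $z\in P^\ast$; $P_{min}$ is the set of minimal elements. For finite $U\subset P$, $\vee U=\{r\in P:\bigcap_{x\in U}xP=rP\}$ ($\vee\emptyset=P^\ast$). A unital contractive representation satisfies $T(e)=I$, $T(pq)=T(p)T(q)$, $\|T(p)\|\le1$. $TT^*(p)=T(p)T(p)^*$; $TT^*(\vee U)=TT^*(r)$ for any $r\in\vee U$ (independent of $r$), and $0$ if $\vee U$ is the empty set. $Z(F)=\sum_{U\subseteq F}(-1)^{|U|}TT^*(\vee U)$; the term $U=\emptyset$ is $I$. *)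

theory Defs
  imports "HOL-Analysis.Bounded_Linear_Function"
begin

section \<open>Complex Hilbert spaces\<close>

text \<open>
  The inner product is linear in its first argument. The axiom \<open>cinner_same\<close> says that
  the norm inherited from \<^class>\<open>banach\<close> is the one induced by the inner product; it also
  yields positive definiteness.
\<close>

class chilbert_space = banach +
  fixes scaleC :: "complex \<Rightarrow> 'a \<Rightarrow> 'a"  (infixr \<open>*\<^sub>C\<close> 75)
    and cinner :: "'a \<Rightarrow> 'a \<Rightarrow> complex"
  assumes scaleC_add_right: "c *\<^sub>C (x + y) = c *\<^sub>C x + c *\<^sub>C y"
    and scaleC_add_left: "(c + d) *\<^sub>C x = c *\<^sub>C x + d *\<^sub>C x"
    and scaleC_scaleC: "c *\<^sub>C (d *\<^sub>C x) = (c * d) *\<^sub>C x"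
    and scaleR_scaleC: "r *\<^sub>R x = complex_of_real r *\<^sub>C x"
    and cinner_commute: "cinner x y = cnj (cinner y x)"
    and cinner_add_left: "cinner (x + y) z = cinner x z + cinner y z"
    and cinner_scaleC_left: "cinner (c *\<^sub>C x) y = c * cinner x y"
    and cinner_same: "cinner x x = complex_of_real ((norm x)\<^sup>2)"

text \<open>
  \<open>\<B>(\<H>)\<close> is the set of complex-linear members of the library type of bounded real-linear
  operators; sums, composition, identity and operator norm are those of that type.
\<close>

definition bounded_ops :: "('h::chilbert_space \<Rightarrow>\<^sub>L 'h) set"  (\<open>\<B>\<close>)
  where "\<B> = {A :: 'h \<Rightarrow>\<^sub>L 'h. \<forall>c x. A (c *\<^sub>C x) = c *\<^sub>C A x}"

text \<open>By the Riesz representation theorem exactly one such operator exists for \<open>A \<in> \<B>\<close>.\<close>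

definition adj :: "('h::chilbert_space \<Rightarrow>\<^sub>L 'h) \<Rightarrow> ('h \<Rightarrow>\<^sub>L 'h)"
  where "adj A = (THE B. B \<in> \<B> \<and> (\<forall>x y. cinner (A x) y = cinner x (B y)))"

definition positive_op :: "('h::chilbert_space \<Rightarrow>\<^sub>L 'h) \<Rightarrow> bool"
  where "positive_op A \<longleftrightarrow>
    A \<in> \<B> \<and> (\<forall>x. Im (cinner (A x) x) = 0 \<and> 0 \<le> Re (cinner (A x) x))"


section \<open>Right LCM semigroups\<close>

text \<open>
  A unital semigroup \<open>P\<close> is a type of class \<^class>\<open>monoid_mult\<close>; properties of \<open>P\<close>
  itself take the type as an argument.
\<close>

definition invertibles :: "'p::monoid_mult set"
  where "invertibles = {x. \<exists>y. x * y = 1 \<and> y * x = 1}"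

definition right_ideal :: "'p::monoid_mult \<Rightarrow> 'p set"
  where "right_ideal p = range (\<lambda>a. p * a)"

definition right_LCM :: "'p::monoid_mult itself \<Rightarrow> bool"
  where "right_LCM _ \<longleftrightarrow>
    (\<forall>p a b :: 'p. p * a = p * b \<longrightarrow> a = b) \<and>
    (\<forall>p q :: 'p. right_ideal p \<inter> right_ideal q = {} \<or>
      (\<exists>r. right_ideal p \<inter> right_ideal q = right_ideal r))"

definition Ore :: "'p::monoid_mult itself \<Rightarrow> bool"
  where "Ore _ \<longleftrightarrow> (\<forall>p q :: 'p. right_ideal p \<inter> right_ideal q \<noteq> {})"

definition descending_chain_condition :: "'p::monoid_mult itself \<Rightarrow> bool"
  where "descending_chain_condition _ \<longleftrightarrow>
    \<not> (\<exists>(x :: nat \<Rightarrow> 'p) (y :: nat \<Rightarrow> 'p). \<forall>n. y n \<notin> invertibles \<and>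
         (x n = x (Suc n) * y n \<or> x n = y n * x (Suc n)))"

definition minimals :: "'p::monoid_mult set"
  where "minimals = {x. x \<notin> invertibles \<and>
    (\<forall>y z. x = y * z \<longrightarrow> y \<in> invertibles \<or> z \<in> invertibles)}"

text \<open>For \<open>U = {}\<close> the intersection is the whole semigroup.\<close>

definition lcms :: "'p::monoid_mult set \<Rightarrow> 'p set"
  where "lcms U = {r. (\<Inter>x\<in>U. right_ideal x) = right_ideal r}"


section \<open>Representations\<close>

definition contractive_rep :: "('p::monoid_mult \<Rightarrow> ('h::chilbert_space \<Rightarrow>\<^sub>L 'h)) \<Rightarrow> bool"
  where "contractive_rep T \<longleftrightarrow>
    range T \<subseteq> \<B> \<and>
    T 1 = id_blinfun \<and>
    (\<forall>p q. T (p * q) = T p o\<^sub>L T q) \<and>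
    (\<forall>p. norm (T p) \<le> 1)"

definition TTstar :: "('p::monoid_mult \<Rightarrow> ('h::chilbert_space \<Rightarrow>\<^sub>L 'h)) \<Rightarrow> 'p \<Rightarrow> ('h \<Rightarrow>\<^sub>L 'h)"
  where "TTstar T p = T p o\<^sub>L adj (T p)"

text \<open>
  Over a right LCM semigroup two elements of \<open>lcms U\<close> differ by an invertible factor, and a
  unital contractive representation maps invertible elements to unitaries, so the choice of
  the element does not matter.
\<close>

definition TTstar_lcm ::
    "('p::monoid_mult \<Rightarrow> ('h::chilbert_space \<Rightarrow>\<^sub>L 'h)) \<Rightarrow> 'p set \<Rightarrow> ('h \<Rightarrow>\<^sub>L 'h)"
  where "TTstar_lcm T U =
    (if lcms U = {} then 0 else TTstar T (SOME r. r \<in> lcms U))"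

definition Z :: "('p::monoid_mult \<Rightarrow> ('h::chilbert_space \<Rightarrow>\<^sub>L 'h)) \<Rightarrow> 'p set \<Rightarrow> ('h \<Rightarrow>\<^sub>L 'h)"
  where "Z T F = (\<Sum>U\<in>Pow F. (- 1) ^ card U *\<^sub>R TTstar_lcm T U)"

end

theory Submission
  imports Defs
begin

text \<open>
  Think of \<open>TT\<^sup>*(r)\<close> as the value of a finitely additive set function on the ideal \<open>rP\<close>; then
  \<open>Z(F)\<close> is its value on the complement of \<open>\<Union>p\<in>F. pP\<close>. Splitting
  \<open>P - abP\<close> into \<open>P - aP\<close> and \<open>a(P - bP)\<close> gives
  \<open>Z({ab} \<union> F) = Z({a} \<union> F) + T(a) Z({b} \<union> F') T(a)\<^sup>*\<close>, where \<open>F'\<close> consists of elements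
  \<open>s\<close> with \<open>asP = aP \<inter> pP\<close>, one for each \<open>p \<in> F\<close>. The elements of \<open>F'\<close> need not be smaller than those of
  \<open>F\<close>, but if \<open>abt\<close> is a common right multiple of \<open>{ab} \<union> F\<close>, then \<open>bt\<close> is one of
  \<open>{b} \<union> F'\<close>. With \<open>a\<close> minimal, positivity follows by well-founded induction on a common right
  multiple of \<open>F\<close>, and then on the number of elements of \<open>F\<close> that are not minimal.
\<close>

section \<open>Adjoints\<close>

lemma cinner_add_right:
  fixes x :: "'h::chilbert_space"
  shows "cinner x (y + z) = cinner x y + cinner x z"
  by (metis cinner_add_left cinner_commute complex_cnj_add)

lemma cinner_scaleC_right:
  fixes x :: "'h::chilbert_space"
  shows "cinner x (c *\<^sub>C y) = cnj c * cinner x y"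
  by (metis cinner_commute cinner_scaleC_left complex_cnj_mult)

lemma cinner_scaleR_left:
  fixes x :: "'h::chilbert_space"
  shows "cinner (r *\<^sub>R x) y = of_real r * cinner x y"
  by (simp add: scaleR_scaleC cinner_scaleC_left)

lemma cinner_scaleR_right:
  fixes x :: "'h::chilbert_space"
  shows "cinner x (r *\<^sub>R y) = of_real r * cinner x y"
  by (simp add: scaleR_scaleC cinner_scaleC_right)

lemma cinner_minus_left:
  fixes x :: "'h::chilbert_space"
  shows "cinner (- x) y = - cinner x y"
  using cinner_scaleR_left[of "-1" x y] by simp

lemma cinner_minus_right:
  fixes x :: "'h::chilbert_space"
  shows "cinner x (- y) = - cinner x y"
  using cinner_scaleR_right[of x "-1" y] by simp

lemma cinner_diff_right:
  fixes x :: "'h::chilbert_space"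
  shows "cinner x (y - z) = cinner x y - cinner x z"
  using cinner_add_right[of x y "- z"] by (simp add: cinner_minus_right)

lemma Re_cinner_commute:
  fixes x :: "'h::chilbert_space"
  shows "Re (cinner x y) = Re (cinner y x)"
  by (subst cinner_commute) simp

lemma norm_add_square:
  fixes x :: "'h::chilbert_space"
  shows "(norm (x + y))\<^sup>2 = (norm x)\<^sup>2 + 2 * Re (cinner x y) + (norm y)\<^sup>2"
proof -
  have "(norm (x + y))\<^sup>2 = Re (cinner (x + y) (x + y))"
    by (simp add: cinner_same)
  also have "\<dots> = Re (cinner x x) + Re (cinner x y) + Re (cinner y x) + Re (cinner y y)"
    by (simp add: cinner_add_left cinner_add_right)
  finally show ?thesis
    by (simp add: cinner_same Re_cinner_commute[of y x])
qed

lemma Re_cinner_le: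
  fixes x :: "'h::chilbert_space"
  shows "Re (cinner x y) \<le> norm x * norm y"
proof -
  have "(norm (x + y))\<^sup>2 \<le> (norm x + norm y)\<^sup>2"
    by (intro power_mono norm_triangle_ineq) simp
  then show ?thesis
    unfolding norm_add_square by (simp add: power2_sum)
qed

lemma abs_Re_cinner_le:
  fixes x :: "'h::chilbert_space"
  shows "\<bar>Re (cinner x y)\<bar> \<le> norm x * norm y"
  using Re_cinner_le[of x y] Re_cinner_le[of "- x" y] by (simp add: cinner_minus_left)

lemma Re_cinner_eqI:
  fixes y :: "'h::chilbert_space"
  assumes "\<And>x. Re (cinner x y) = Re (cinner x z)"
  shows "y = z"
proof -
  have "Re (cinner (y - z) (y - z)) = 0"
    using assms[of "y - z"] by (simp add: cinner_diff_right)
  then show ?thesis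
    by (simp add: cinner_same)
qed

text \<open>Multiplying the first argument by the imaginary unit turns minus the imaginary part into
  the real part, so identities of real parts extend to the complex form.\<close>

lemma cinner_eq_of_Re:
  fixes x :: "'h::chilbert_space" and w :: "'k::chilbert_space"
  assumes "Re (cinner x y) = Re (cinner w z)"
    and "Re (cinner (\<i> *\<^sub>C x) y) = Re (cinner (\<i> *\<^sub>C w) z)"
  shows "cinner x y = cinner w z"
  using assms by (simp add: complex_eq_iff cinner_scaleC_left)

text \<open>
  Riesz representation: the representing vector minimises \<open>\<parallel>x\<parallel>\<^sup>2 - 2 f x\<close>, and the
  parallelogram law makes every minimising sequence Cauchy.
\<close>

lemma riesz_real:
  fixes f :: "'h::chilbert_space \<Rightarrow> real"
  assumes "bounded_linear f"
  shows "\<exists>z. \<forall>x. f x = Re (cinner x z)"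
proof -
  interpret f: bounded_linear f by fact
  obtain K where K: "\<And>x. norm (f x) \<le> norm x * K"
    using f.bounded by blast
  define J where "J x = (norm x)\<^sup>2 - 2 * f x" for x
  have low: "- K\<^sup>2 \<le> J x" for x
  proof -
    have "f x \<le> norm x * K"
      using K[of x] by simp
    moreover have "0 \<le> (norm x - K)\<^sup>2"
      by simp
    ultimately show ?thesis
      unfolding J_def by (simp add: power2_diff)
  qed
  define m where "m = Inf (range J)"
  have bdd: "bdd_below (range J)"
    using low by (auto simp: bdd_below_def)
  have m_le: "m \<le> J x" for x
    unfolding m_def by (rule cInf_lower[OF _ bdd]) simp
  have "\<exists>x. J x < m + 1 / real (Suc n)" for n
    using cInf_lessD[of "range J" "m + 1 / real (Suc n)"] unfolding m_def by auto
  then obtain X where X: "\<And>n. J (X n) < m + 1 / real (Suc n)"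
    by metis
  \<comment> \<open>Parallelogram law in terms of \<open>J\<close>: the linear parts cancel, so two
    points with \<open>J\<close> close to its infimum \<open>m\<close> are close to each
    other.\<close>
  have par: "(norm (x - y))\<^sup>2 = 2 * J x + 2 * J y - 4 * J ((1/2) *\<^sub>R (x + y))" for x y
  proof -
    have "J ((1/2) *\<^sub>R (x + y)) = (norm (x + y))\<^sup>2 / 4 - (f x + f y)"
      by (simp add: J_def f.scaleR f.add power_divide add_divide_distrib del: scaleR_add_right)
    moreover have "(norm (x - y))\<^sup>2 = (norm x)\<^sup>2 - 2 * Re (cinner x y) + (norm y)\<^sup>2"
      using norm_add_square[of x "- y"] by (simp add: cinner_minus_right)
    ultimately show ?thesis
      using norm_add_square[of x y] J_def[of x] J_def[of y] by linarith
  qed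
  have "Cauchy X"
  proof (rule metric_CauchyI)
    fix e :: real assume "0 < e"
    then obtain N :: nat where N: "4 / e\<^sup>2 < real N"
      using reals_Archimedean2 by blast
    have "dist (X i) (X j) < e" if "i \<ge> N" "j \<ge> N" for i j
    proof -
      have small: "1 / real (Suc k) < e\<^sup>2 / 4" if "k \<ge> N" for k
      proof -
        have "4 / e\<^sup>2 < real (Suc k)"
          using N that by simp
        then show ?thesis
          using \<open>0 < e\<close> by (simp add: field_simps)
      qed
      have "(norm (X i - X j))\<^sup>2 < e\<^sup>2"
        using par[of "X i" "X j"] m_le[of "(1/2) *\<^sub>R (X i + X j)"] X[of i] X[of j]
          small[OF \<open>i \<ge> N\<close>] small[OF \<open>j \<ge> N\<close>] by linarith
      then show ?thesis
        using \<open>0 < e\<close> by (simp add: dist_norm power2_less_imp_less)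
    qed
    then show "\<exists>M. \<forall>i\<ge>M. \<forall>j\<ge>M. dist (X i) (X j) < e"
      by blast
  qed
  then obtain z where z: "X \<longlonglongrightarrow> z"
    using Cauchy_convergent convergent_def by blast
  have "(\<lambda>n. J (X n)) \<longlonglongrightarrow> J z"
    unfolding J_def by (intro tendsto_intros z f.tendsto)
  moreover have "(\<lambda>n. m + 1 / real (Suc n)) \<longlonglongrightarrow> m + 0"
    by (rule tendsto_add[OF tendsto_const LIMSEQ_Suc[OF lim_1_over_n]])
  ultimately have "J z \<le> m + 0"
    by (rule LIMSEQ_le) (use X less_imp_le in blast)
  then have min: "J z \<le> J y" for y
    using m_le[of y] by simp
  have "f h = Re (cinner h z)" for h
  proof -
    define c where "c = Re (cinner h z) - f h"
    define N where "N = (norm h)\<^sup>2"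
    \<comment> \<open>The value \<open>- c / N\<close> would minimise \<open>J\<close> along
      \<open>h\<close>; \<open>N + 1\<close> also allows \<open>h = 0\<close>. Clearing
      denominators, minimality of \<open>z\<close> gives
      \<open>0 \<le> - c\<^sup>2 * (N + 2)\<close>, hence \<open>c = 0\<close>.\<close>
    define t where "t = - c / (N + 1)"
    have N: "0 \<le> N"
      by (simp add: N_def)
    have "J (z + t *\<^sub>R h) = J z + 2 * t * c + t\<^sup>2 * N"
      unfolding J_def norm_add_square c_def N_def
      by (simp add: f.add f.scaleR cinner_scaleR_right Re_cinner_commute[of z h] power_mult_distrib
          algebra_simps)
    then have "0 \<le> (2 * t * c + t\<^sup>2 * N) * (N + 1)\<^sup>2"
      using min[of "z + t *\<^sub>R h"] by simp
    also have "\<dots> = 2 * (t * (N + 1)) * c * (N + 1) + (t * (N + 1))\<^sup>2 * N"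
      by (simp add: power2_eq_square algebra_simps)
    also have "t * (N + 1) = - c"
      using N by (simp add: t_def)
    also have "2 * (- c) * c * (N + 1) + (- c)\<^sup>2 * N = - (c\<^sup>2 * (N + 2))"
      by (simp add: power2_eq_square algebra_simps)
    finally have "c\<^sup>2 * (N + 2) \<le> 0"
      by simp
    then have "c = 0"
      using N by (simp add: mult_le_0_iff)
    then show ?thesis
      by (simp add: c_def)
  qed
  then show ?thesis
    by blast
qed

text \<open>For each \<open>y\<close>, Riesz represents the real part of
  \<open>cinner (A x) y\<close>; complex linearity of \<open>A\<close> then supplies the imaginary
  part.\<close>

lemma adjoint_exists:
  fixes A :: "'h::chilbert_space \<Rightarrow>\<^sub>L 'h"
  assumes "A \<in> \<B>"
  shows "\<exists>B\<in>\<B>. \<forall>x y. cinner (A x) y = cinner x (B y)"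
proof -
  have "bounded_linear (\<lambda>x. Re (cinner (A x) y))" for y
  proof (rule bounded_linear_intro)
    show "norm (Re (cinner (A x) y)) \<le> norm x * (norm A * norm y)" for x
    proof -
      have "norm (Re (cinner (A x) y)) \<le> norm (A x) * norm y"
        using abs_Re_cinner_le by simp
      also have "\<dots> \<le> (norm A * norm x) * norm y"
        by (intro mult_right_mono norm_blinfun) simp
      finally show ?thesis
        by (simp add: mult_ac)
    qed
  qed (simp_all add: blinfun.add_right blinfun.scaleR_right cinner_add_left cinner_scaleR_left)
  then have "\<exists>z. \<forall>x. Re (cinner (A x) y) = Re (cinner x z)" for y
    by (rule riesz_real)
  then obtain b where b: "\<And>x y. Re (cinner (A x) y) = Re (cinner x (b y))"
    by metis
  have bc: "cinner (A x) y = cinner x (b y)" for x y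
  proof (rule cinner_eq_of_Re)
    have "\<i> *\<^sub>C A x = A (\<i> *\<^sub>C x)"
      using assms by (simp add: bounded_ops_def)
    then show "Re (cinner (\<i> *\<^sub>C A x) y) = Re (cinner (\<i> *\<^sub>C x) (b y))"
      using b by simp
  qed (rule b)
  have b_scaleC: "b (c *\<^sub>C y) = c *\<^sub>C b y" for c y
    by (rule Re_cinner_eqI) (simp add: cinner_scaleC_right flip: bc)
  have "bounded_linear b"
  proof (rule bounded_linear_intro)
    show "b (x + y) = b x + b y" for x y
      by (rule Re_cinner_eqI) (simp add: cinner_add_right flip: bc)
    show "b (r *\<^sub>R x) = r *\<^sub>R b x" for r x
      by (simp add: scaleR_scaleC b_scaleC)
    show "norm (b y) \<le> norm y * norm A" for y
    proof (cases "b y = 0")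
      case False
      have "norm (b y) * norm (b y) = Re (cinner (A (b y)) y)"
        by (simp add: bc cinner_same power2_eq_square)
      also have "\<dots> \<le> norm (A (b y)) * norm y"
        by (rule Re_cinner_le)
      also have "\<dots> \<le> (norm A * norm (b y)) * norm y"
        by (intro mult_right_mono norm_blinfun) simp
      finally show ?thesis
        using False by (simp add: mult_ac)
    qed simp
  qed
  then show ?thesis
    using bc b_scaleC
    by (intro bexI[of _ "Blinfun b"]) (simp_all add: bounded_ops_def bounded_linear_Blinfun_apply)
qed

lemma adj_eqI:
  fixes A :: "'h::chilbert_space \<Rightarrow>\<^sub>L 'h"
  assumes "B \<in> \<B>" and "\<And>x y. cinner (A x) y = cinner x (B y)"
  shows "adj A = B"
  unfolding adj_def
proof (rule the_equality)
  fix C :: "'h \<Rightarrow>\<^sub>L 'h"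
  assume C: "C \<in> \<B> \<and> (\<forall>x y. cinner (A x) y = cinner x (C y))"
  show "C = B"
  proof (rule blinfun_eqI)
    fix y
    show "C y = B y"
      by (rule Re_cinner_eqI) (metis C assms(2))
  qed
qed (use assms in blast)

lemma adj_in_bounded_ops:
  fixes A :: "'h::chilbert_space \<Rightarrow>\<^sub>L 'h"
  assumes "A \<in> \<B>"
  shows "adj A \<in> \<B>"
  using adjoint_exists[OF assms] adj_eqI by metis

lemma cinner_adj:
  fixes A :: "'h::chilbert_space \<Rightarrow>\<^sub>L 'h"
  assumes "A \<in> \<B>"
  shows "cinner (A x) y = cinner x (adj A y)"
  using adjoint_exists[OF assms] adj_eqI by metis

lemma bounded_ops_compose:
  fixes A B :: "'h::chilbert_space \<Rightarrow>\<^sub>L 'h"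
  assumes "A \<in> \<B>" "B \<in> \<B>"
  shows "A o\<^sub>L B \<in> \<B>"
  using assms by (simp add: bounded_ops_def)

lemma adj_compose:
  fixes A B :: "'h::chilbert_space \<Rightarrow>\<^sub>L 'h"
  assumes "A \<in> \<B>" "B \<in> \<B>"
  shows "adj (A o\<^sub>L B) = adj B o\<^sub>L adj A"
  using assms by (intro adj_eqI bounded_ops_compose adj_in_bounded_ops) (simp_all add: cinner_adj)

text \<open>Two mutually inverse contractions are isometries, and by polarisation they preserve the
  inner product. This makes \<open>T\<close> unitary on invertible elements.\<close>

lemma adj_contractive_inverse:
  fixes A B :: "'h::chilbert_space \<Rightarrow>\<^sub>L 'h"
  assumes "A \<in> \<B>" "B \<in> \<B>" "norm A \<le> 1" "norm B \<le> 1"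
    and "A o\<^sub>L B = id_blinfun" "B o\<^sub>L A = id_blinfun"
  shows "adj A = B"
proof (rule adj_eqI)
  have AB: "A (B x) = x" and BA: "B (A x) = x" for x
    using assms(5,6) by (metis blinfun_apply_blinfun_compose blinfun_apply_id_blinfun id_apply)+
  have le: "norm (C x) \<le> norm x" if "norm C \<le> 1" for C :: "'h \<Rightarrow>\<^sub>L 'h" and x
    using norm_blinfun[of C x] mult_right_mono[OF that norm_ge_zero[of x]] by simp
  have iso: "norm (A x) = norm x" for x
    using le[OF assms(3), of x] le[OF assms(4), of "A x"] by (simp add: BA)
  have re: "Re (cinner (A x) (A y)) = Re (cinner x y)" for x y
    using norm_add_square[of "A x" "A y"] norm_add_square[of x y] iso[of "x + y"]
    by (simp add: iso blinfun.add_right)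
  have "\<i> *\<^sub>C A x = A (\<i> *\<^sub>C x)" for x
    using assms(1) by (simp add: bounded_ops_def)
  then have "cinner (A x) (A y) = cinner x y" for x y
    by (intro cinner_eq_of_Re) (simp_all add: re)
  then show "cinner (A x) y = cinner x (B y)" for x y
    by (metis AB)
qed fact

section \<open>Positive operators\<close>

lemma positive_op_zero: "positive_op (0 :: 'h::chilbert_space \<Rightarrow>\<^sub>L 'h)"
proof -
  have "c *\<^sub>C (0::'h) = 0" for c
    using scaleC_add_right[of c "0::'h" 0] by simp
  moreover have "cinner 0 x = 0" for x :: 'h
    using cinner_add_left[of "0::'h" 0 x] by simp
  ultimately show ?thesis
    by (simp add: positive_op_def bounded_ops_def)
qed

lemma positive_op_add:
  fixes A B :: "'h::chilbert_space \<Rightarrow>\<^sub>L 'h"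
  assumes "positive_op A" "positive_op B"
  shows "positive_op (A + B)"
  using assms
  by (simp add: positive_op_def bounded_ops_def blinfun.add_left cinner_add_left scaleC_add_right)

lemma positive_op_conjugate:
  fixes A B :: "'h::chilbert_space \<Rightarrow>\<^sub>L 'h"
  assumes "positive_op B" "A \<in> \<B>"
  shows "positive_op (A o\<^sub>L B o\<^sub>L adj A)"
  using assms
  by (simp add: positive_op_def bounded_ops_compose adj_in_bounded_ops cinner_adj[OF assms(2)])


section \<open>Principal right ideals\<close>

definition principal :: "'p::monoid_mult set \<Rightarrow> bool"
  where "principal X \<longleftrightarrow> (\<exists>r. X = right_ideal r)"

lemma principal_right_ideal: "principal (right_ideal r)"
  by (auto simp: principal_def)

lemma mem_right_ideal: "x \<in> right_ideal p \<longleftrightarrow> (\<exists>a. x = p * a)"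
  by (auto simp: right_ideal_def)

lemma right_ideal_mult: "right_ideal (a * b) = (*) a ` right_ideal b"
  by (auto simp: right_ideal_def mult.assoc image_image)

lemma right_ideal_invertible:
  assumes "p \<in> invertibles"
  shows "right_ideal p = UNIV"
proof -
  obtain q where "p * q = 1"
    using assms by (auto simp: invertibles_def)
  then have "x = p * (q * x)" for x
    by (simp flip: mult.assoc)
  then show ?thesis
    by (metis UNIV_eq_I mem_right_ideal)
qed

lemma right_ideal_1: "right_ideal 1 = UNIV"
  by (auto simp: right_ideal_def)

lemma left_cancel:
  fixes p :: "'p::monoid_mult"
  assumes "right_LCM TYPE('p)" "p * a = p * b"
  shows "a = b"
  using assms unfolding right_LCM_def by blast

lemma principal_Int:
  fixes X Y :: "'p::monoid_mult set"
  assumes "right_LCM TYPE('p)" "Ore TYPE('p)" "principal X" "principal Y"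
  shows "principal (X \<inter> Y)"
  using assms unfolding right_LCM_def Ore_def principal_def by metis

text \<open>Each generator is a right multiple of the other; left cancellation makes the two factors
  mutually inverse.\<close>

lemma right_ideal_eqD:
  fixes r s :: "'p::monoid_mult"
  assumes "right_LCM TYPE('p)" "right_ideal r = right_ideal s"
  shows "\<exists>u v. s = r * u \<and> u * v = 1 \<and> v * u = 1"
proof -
  have "s \<in> right_ideal r" "r \<in> right_ideal s"
    using assms(2) mem_right_ideal[of s s] mem_right_ideal[of r r] by (metis mult.right_neutral)+
  then obtain u v where u: "s = r * u" and v: "r = s * v"
    by (auto simp: mem_right_ideal)
  have "r * (u * v) = r * 1" "s * (v * u) = s * 1"
    using u v by (metis mult.assoc mult.right_neutral)+
  then show ?thesis
    using u left_cancel[OF assms(1)] by blast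
qed

lemma residual_exists:
  fixes a p :: "'p::monoid_mult"
  assumes "right_LCM TYPE('p)" "Ore TYPE('p)"
  shows "\<exists>s. right_ideal (a * s) = right_ideal a \<inter> right_ideal p"
proof -
  obtain r where r: "right_ideal a \<inter> right_ideal p = right_ideal r"
    using principal_Int[OF assms principal_right_ideal principal_right_ideal]
    unfolding principal_def by blast
  have "r \<in> right_ideal r"
    by (metis mem_right_ideal mult.right_neutral)
  then have "r \<in> right_ideal a"
    using r by blast
  then show ?thesis
    using r by (auto simp: mem_right_ideal)
qed

lemma common_multiple_exists:
  fixes F :: "'p::monoid_mult set"
  assumes "right_LCM TYPE('p)" "Ore TYPE('p)" "finite F"
  shows "\<exists>r. \<forall>p\<in>F. r \<in> right_ideal p"
  using assms(3)
proof (induction F)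
  case (insert p F)
  then obtain r where r: "\<forall>q\<in>F. r \<in> right_ideal q"
    by blast
  obtain s where "s \<in> right_ideal p" "s \<in> right_ideal r"
    using assms(2) unfolding Ore_def by blast
  then show ?case
    using r by (metis insert_iff mem_right_ideal mult.assoc)
qed simp

text \<open>Allows descent to factors on either side: left factors serve to split off a minimal
  element, right factors to shrink a common multiple.\<close>

lemma wf_proper_factor:
  assumes "descending_chain_condition TYPE('p::monoid_mult)"
  shows "wf {(x', x :: 'p). \<exists>y. y \<notin> invertibles \<and> (x = x' * y \<or> x = y * x')}"
  unfolding wf_iff_no_infinite_down_chain
proof
  assume "\<exists>f. \<forall>i. (f (Suc i), f i) \<in> {(x', x :: 'p). \<exists>y. y \<notin> invertibles \<and> (x = x' * y \<or> x = y * x')}"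
  then obtain f :: "nat \<Rightarrow> 'p" where
    "\<forall>i. \<exists>y. y \<notin> invertibles \<and> (f i = f (Suc i) * y \<or> f i = y * f (Suc i))"
    by auto
  then have "\<exists>y. \<forall>i. y i \<notin> invertibles \<and> (f i = f (Suc i) * y i \<or> f i = y i * f (Suc i))"
    by (rule choice)
  then show False
    using assms unfolding descending_chain_condition_def by blast
qed

lemma minimal_left_factor:
  assumes "descending_chain_condition TYPE('p::monoid_mult)" and "(p :: 'p) \<notin> invertibles"
  shows "\<exists>a b. a \<in> minimals \<and> p = a * b"
  using assms(2)
proof (induction p rule: wf_induct_rule[OF wf_proper_factor[OF assms(1)]])
  case (1 p)
  show ?case
  proof (cases "p \<in> minimals")
    case True
    then show ?thesis
      by (metis mult.right_neutral)
  next
    case False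
    then obtain y z where yz: "p = y * z" "y \<notin> invertibles" "z \<notin> invertibles"
      using 1 unfolding minimals_def by blast
    then obtain a b where "a \<in> minimals" "y = a * b"
      using 1(1)[of y] by blast
    then show ?thesis
      using yz by (metis mult.assoc)
  qed
qed


section \<open>Inclusion-exclusion inside an ideal\<close>

text \<open>\<open>ideal_op T (rP)\<close> is \<open>TT\<^sup>*(r)\<close>, and \<open>defect T X F\<close> is the value on \<open>X - (\<Union>p\<in>F. pP)\<close>.\<close>

definition ideal_op ::
    "('p::monoid_mult \<Rightarrow> ('h::chilbert_space \<Rightarrow>\<^sub>L 'h)) \<Rightarrow> 'p set \<Rightarrow> ('h \<Rightarrow>\<^sub>L 'h)"
  where "ideal_op T X = (if principal X then TTstar T (SOME r. X = right_ideal r) else 0)"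

definition defect ::
    "('p::monoid_mult \<Rightarrow> ('h::chilbert_space \<Rightarrow>\<^sub>L 'h)) \<Rightarrow> 'p set \<Rightarrow> 'p set \<Rightarrow> ('h \<Rightarrow>\<^sub>L 'h)"
  where "defect T X F =
    (\<Sum>U\<in>Pow F. (- 1) ^ card U *\<^sub>R ideal_op T (X \<inter> (\<Inter>x\<in>U. right_ideal x)))"

text \<open>Both sides select a generator by the same \<open>SOME\<close> condition, so the sums
  agree term by term.\<close>

lemma Z_eq_defect: "Z T F = defect T UNIV F"
  unfolding Z_def defect_def TTstar_lcm_def ideal_op_def lcms_def principal_def
  by (intro sum.cong refl) auto

lemma defect_empty: "defect T X {} = ideal_op T X"
  by (simp add: defect_def)

text \<open>
  For \<open>p \<in> F\<close> the subtracted term vanishes; this is why it does no harm below that residuals of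
  distinct elements may coincide.
\<close>

lemma defect_insert:
  assumes "finite F"
  shows "defect T X (insert p F) = defect T X F - defect T (X \<inter> right_ideal p) F"
proof -
  \<comment> \<open>For \<open>p\<close> outside \<open>G\<close>, subsets split by whether they
    contain \<open>p\<close>; adding \<open>p\<close> flips the sign and intersects \<open>Y\<close>
    with \<open>right_ideal p\<close>.\<close>
  have new: "defect T Y (insert p G) = defect T Y G - defect T (Y \<inter> right_ideal p) G"
    if "finite G" "p \<notin> G" for Y G
  proof -
    let ?g = "\<lambda>U. (- 1) ^ card U *\<^sub>R ideal_op T (Y \<inter> (\<Inter>x\<in>U. right_ideal x))"
    have "defect T Y (insert p G) = sum ?g (Pow G) + sum ?g (insert p ` Pow G)"
      unfolding defect_def Pow_insert using that by (intro sum.union_disjoint) auto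
    also have "sum ?g (insert p ` Pow G) = (\<Sum>U\<in>Pow G. ?g (insert p U))"
      using that by (subst sum.reindex) (auto simp: inj_on_def)
    also have "\<dots> = (\<Sum>U\<in>Pow G. - ((- 1) ^ card U *\<^sub>R
        ideal_op T ((Y \<inter> right_ideal p) \<inter> (\<Inter>x\<in>U. right_ideal x))))"
    proof (intro sum.cong refl)
      fix U assume "U \<in> Pow G"
      then have "finite U" "p \<notin> U"
        using that by (auto intro: finite_subset)
      then show "?g (insert p U) =
          - ((- 1) ^ card U *\<^sub>R ideal_op T ((Y \<inter> right_ideal p) \<inter> (\<Inter>x\<in>U. right_ideal x)))"
        by (simp add: Int_assoc)
    qed
    finally show ?thesis
      unfolding defect_def by (simp add: sum_negf)
  qed
  show ?thesis
  proof (cases "p \<in> F")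
    case True
    then have F: "F = insert p (F - {p})"
      by blast
    \<comment> \<open>Intersecting with \<open>right_ideal p\<close> a second time changes nothing,
      so the two terms given by \<open>new\<close> cancel.\<close>
    have "defect T (X \<inter> right_ideal p) F = 0"
      by (subst F, subst new) (use assms in \<open>simp_all add: Int_assoc\<close>)
    then show ?thesis
      using True by (simp add: insert_absorb)
  qed (use new assms in blast)
qed

section \<open>Conjugating inclusion-exclusion sums by \<open>T a\<close>\<close>

context
  fixes T :: "'p::monoid_mult \<Rightarrow> ('h::chilbert_space \<Rightarrow>\<^sub>L 'h)"
  assumes lcm: "right_LCM TYPE('p)"
    and rep: "contractive_rep T"
begin

lemma rep_bounded: "T p \<in> \<B>"
  using rep by (auto simp: contractive_rep_def)

lemma rep_mult: "T (p * q) = T p o\<^sub>L T q"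
  using rep by (simp add: contractive_rep_def)

lemma TTstar_mult: "TTstar T (p * q) = T p o\<^sub>L TTstar T q o\<^sub>L adj (T p)"
  by (rule blinfun_eqI) (simp add: TTstar_def rep_mult adj_compose rep_bounded)

lemma TTstar_invertible:
  assumes "u * v = 1" "v * u = 1"
  shows "TTstar T u = id_blinfun"
proof -
  have "T u o\<^sub>L T v = id_blinfun" "T v o\<^sub>L T u = id_blinfun"
    using assms rep by (simp_all add: contractive_rep_def flip: rep_mult)
  moreover have "norm (T w) \<le> 1" for w
    using rep by (simp add: contractive_rep_def)
  ultimately have "adj (T u) = T v"
    by (intro adj_contractive_inverse rep_bounded)
  then show ?thesis
    using \<open>T u o\<^sub>L T v = id_blinfun\<close> by (simp add: TTstar_def)
qed

text \<open>Independence of the generator: two choices differ by an invertible \<open>u\<close>, and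
  \<open>TTstar T u\<close> is the identity.\<close>

lemma ideal_op_right_ideal: "ideal_op T (right_ideal r) = TTstar T r"
proof -
  have ex: "\<exists>s. right_ideal r = right_ideal s"
    by blast
  define s where "s = (SOME s. right_ideal r = right_ideal s)"
  have "right_ideal r = right_ideal s"
    unfolding s_def by (rule someI_ex[OF ex])
  then obtain u v where "s = r * u" "u * v = 1" "v * u = 1"
    using right_ideal_eqD[OF lcm] by blast
  then have "TTstar T s = TTstar T r"
    by (intro blinfun_eqI) (simp add: TTstar_mult TTstar_invertible, simp add: TTstar_def)
  then show ?thesis
    by (simp add: ideal_op_def principal_right_ideal s_def)
qed

text \<open>Left multiplication by \<open>a\<close> carries \<open>X\<close> minus the ideals of the
  residuals onto \<open>aX\<close> minus the ideals of \<open>F\<close>, and conjugates each value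
  by \<open>T a\<close>. The induction keeps \<open>X\<close> arbitrary because
  \<open>defect_insert\<close> shrinks it.\<close>

lemma defect_residual:
  assumes ore: "Ore TYPE('p)" and "finite F" and "principal X"
    and "\<And>p. p \<in> F \<Longrightarrow> right_ideal (a * s p) = right_ideal a \<inter> right_ideal p"
  shows "defect T ((*) a ` X) F = T a o\<^sub>L defect T X (s ` F) o\<^sub>L adj (T a)"
  using assms(2-)
proof (induction F arbitrary: X)
  case empty
  then obtain r where "X = right_ideal r"
    by (auto simp: principal_def)
  then show ?case
    by (simp add: defect_empty ideal_op_right_ideal TTstar_mult flip: right_ideal_mult)
next
  case (insert p F)
  have "(*) a ` X \<inter> right_ideal p = (*) a ` X \<inter> (right_ideal a \<inter> right_ideal p)"
    by (auto simp: right_ideal_def)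
  also have "\<dots> = (*) a ` X \<inter> (*) a ` right_ideal (s p)"
    using insert.prems(2)[of p] by (simp add: right_ideal_mult)
  also have "\<dots> = (*) a ` (X \<inter> right_ideal (s p))"
    \<comment> \<open>Left cancellation makes multiplication by \<open>a\<close> injective, so
      images commute with intersections.\<close>
    by (rule image_Int[symmetric]) (auto intro: injI dest: left_cancel[OF lcm])
  finally have int: "(*) a ` X \<inter> right_ideal p = (*) a ` (X \<inter> right_ideal (s p))" .
  have "principal (X \<inter> right_ideal (s p))"
    by (intro principal_Int lcm ore insert.prems principal_right_ideal)
  then have "defect T ((*) a ` X) (insert p F) =
      (T a o\<^sub>L defect T X (s ` F) o\<^sub>L adj (T a))
      - (T a o\<^sub>L defect T (X \<inter> right_ideal (s p)) (s ` F) o\<^sub>L adj (T a))"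
    using insert by (simp add: defect_insert int)
  also have "\<dots> = T a o\<^sub>L defect T X (s ` insert p F) o\<^sub>L adj (T a)"
    using insert.hyps
    by (intro blinfun_eqI) (simp add: defect_insert blinfun.diff_left blinfun.diff_right)
  finally show ?case .
qed

lemma Z_insert_mult:
  assumes "Ore TYPE('p)" and "finite F"
    and "\<And>p. p \<in> F \<Longrightarrow> right_ideal (a * s p) = right_ideal a \<inter> right_ideal p"
  shows "Z T (insert (a * b) F) =
    Z T (insert a F) + (T a o\<^sub>L Z T (insert b (s ` F)) o\<^sub>L adj (T a))"
proof -
  have conj: "defect T (right_ideal (a * r)) F =
      T a o\<^sub>L defect T (right_ideal r) (s ` F) o\<^sub>L adj (T a)" for r
    unfolding right_ideal_mult
    by (rule defect_residual[OF assms(1,2) principal_right_ideal assms(3)])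
  \<comment> \<open>Both sides measure \<open>aP - abP\<close> outside the ideals of
    \<open>F\<close>; \<open>r = 1\<close> and \<open>r = b\<close> in \<open>conj\<close> give the
    two terms.\<close>
  have "T a o\<^sub>L Z T (insert b (s ` F)) o\<^sub>L adj (T a) =
      defect T (right_ideal a) F - defect T (right_ideal (a * b)) F"
    using assms(2) conj[of 1] conj[of b]
    by (intro blinfun_eqI)
      (simp add: Z_eq_defect defect_insert right_ideal_1 blinfun.diff_left blinfun.diff_right)
  then show ?thesis
    using assms(2) by (simp add: Z_eq_defect defect_insert)
qed

end

section \<open>Reduction to minimal elements\<close>

lemma Z_invertible:
  assumes "finite F" "p \<in> F" "p \<in> invertibles"
  shows "Z T F = 0"
  using defect_insert[OF assms(1), of T UNIV p] assms
  by (simp add: Z_eq_defect insert_absorb right_ideal_invertible)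

theorem proposition4p7:
  fixes T :: "'p::monoid_mult \<Rightarrow> ('h::chilbert_space \<Rightarrow>\<^sub>L 'h)"
  assumes "right_LCM TYPE('p)"
    and "Ore TYPE('p)"
    and "descending_chain_condition TYPE('p)"
    and "contractive_rep T"
    and "\<forall>F. finite F \<and> F \<subseteq> minimals \<longrightarrow> positive_op (Z T F)"
  shows "\<forall>F. finite F \<longrightarrow> positive_op (Z T F)"
proof -
  have "positive_op (Z T F)" if "finite F" "\<forall>p\<in>F. r \<in> right_ideal p" for F r
    using that
  proof (induction r arbitrary: F rule: wf_induct_rule[OF wf_proper_factor[OF assms(3)]])
    case (1 r)
    note outer = "1.IH"
    show ?case
      using "1.prems"
    proof (induction "card (F - minimals)" arbitrary: F rule: less_induct)
      case less
      consider "F \<subseteq> minimals" | p where "p \<in> F" "p \<in> invertibles"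
        | p where "p \<in> F" "p \<notin> minimals" "p \<notin> invertibles"
        by blast
      then show ?case
      proof cases
        case 1
        then show ?thesis
          using assms(5) less.prems by blast
      next
        case 2
        then show ?thesis
          using less.prems by (simp add: Z_invertible positive_op_zero)
      next
        case (3 p)
        define G where "G = F - {p}"
        have F: "F = insert p G" "finite G" "p \<notin> G"
          using 3 less.prems by (auto simp: G_def)
        obtain a b where a: "a \<in> minimals" and p: "p = a * b"
          using minimal_left_factor[OF assms(3) 3(3)] by blast
        obtain t where "r = p * t"
          using less.prems 3 by (auto simp: mem_right_ideal)
        then have r: "r = a * (b * t)"
          by (simp add: p mult.assoc)
        obtain s where s: "\<And>q. right_ideal (a * s q) = right_ideal a \<inter> right_ideal q"
          using residual_exists[OF assms(1,2)] by metis
        have r_a: "r \<in> right_ideal a"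
          unfolding mem_right_ideal using r by blast
        have r_G: "r \<in> right_ideal q" if "q \<in> G" for q
          using less.prems(2) that by (simp add: G_def)
        have "positive_op (Z T (insert a G))"
        proof (rule less.hyps)
          \<comment> \<open>Trading \<open>p\<close> for the minimal \<open>a\<close> lowers the
            count of nonminimal elements and keeps \<open>r\<close> as a common multiple.\<close>
          have "insert a G - minimals = G - minimals"
            using a by blast
          moreover have "F - minimals = insert p (G - minimals)"
            unfolding F(1) using 3(2) by blast
          ultimately have "insert a G - minimals \<subset> F - minimals"
            using F(3) by blast
          then show "card (insert a G - minimals) < card (F - minimals)"
            using less.prems by (intro psubset_card_mono) auto
          show "\<forall>q\<in>insert a G. r \<in> right_ideal q"
            using r_a r_G by blast
        qed (use F in simp)
        moreover have "positive_op (Z T (insert b (s ` G)))"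
        proof (rule outer)
          \<comment> \<open>The descent is proper because \<open>a\<close>, being minimal, is not
            invertible.\<close>
          show "(b * t, r) \<in> {(x', x). \<exists>y. y \<notin> invertibles \<and> (x = x' * y \<or> x = y * x')}"
            using a r by (auto simp: minimals_def)
          \<comment> \<open>\<open>r = a * (b * t)\<close> lies in both \<open>right_ideal a\<close>
            and \<open>right_ideal q\<close>, hence in \<open>right_ideal (a * s q)\<close>; cancel
            \<open>a\<close>.\<close>
          have "b * t \<in> right_ideal (s q)" if "q \<in> G" for q
          proof -
            have "r \<in> right_ideal (a * s q)"
              unfolding s using r_a r_G[OF that] by blast
            then obtain w where "a * (b * t) = a * (s q * w)"
              unfolding mem_right_ideal r mult.assoc by blast
            then have "b * t = s q * w"
              by (rule left_cancel[OF assms(1)])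
            then show ?thesis
              unfolding mem_right_ideal by blast
          qed
          then show "\<forall>q\<in>insert b (s ` G). b * t \<in> right_ideal q"
            by (auto simp: mem_right_ideal)
        qed (use F in simp)
        ultimately show ?thesis
          unfolding F(1) p Z_insert_mult[OF assms(1,4,2) F(2) s]
          by (intro positive_op_add positive_op_conjugate rep_bounded[OF assms(1,4)])
      qed
    qed
  qed
  then show ?thesis
    using common_multiple_exists[OF assms(1,2)] by blast
qed

end
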